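(* Let $\mathbf{g}=(\mathbf{y},\mathbf{w},\mathbf{f})\in\mathcal{G}$ be a fixed first-stage decision, and let $\mathfrak{D}(\mathbf{g})$, $Q(\mathbf{g},\mathbf{z})$ and the ambiguity set $\mathscr{D}$ (the probability distributions $\mathbb{P}$ on $\mathfrak{D}(\mathbf{g})$ with $0\le E_{\mathbb{P}}[1-z_{mn,t}]\le \mu^{max}_{mn,t}$ for all $(m,n)\in\mathcal{E}$, $t\in\mathcal{T}$) be as defined in the context. Then $$\max_{\mathbb{P}\in\mathscr{D}} E_{\mathbb{P}}[Q(\mathbf{g},\mathbf{z})]=\min_{\boldsymbol{\beta}\ge 0}\ \max_{\mathbf{z}\in\mathfrak{D}(\mathbf{g})}\Bigl\{Q(\mathbf{g},\mathbf{z})+\sum_{t\in\mathcal{T}}\sum_{(m,n)\in\mathcal{E}}(\mu^{max}_{mn,t}+z_{mn,t}-1)\,\beta_{mn,t}\Bigr\},$$ where $\boldsymbol{\beta}=(\beta_{mn,t})_{(m,n)\in\mathcal{E},\,t\in\mathcal{T}}$ ranges over real vectors with nonnegative entries.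
   Context: **Data.** $\mathcal{T}=\{1,\dots,T\}$ is a finite set of time periods. $G=(\mathcal{N},\mathcal{E})$ is a finite directed graph (nodes and candidate lines), and $\mathcal{R}\subset\mathcal{N}$ is the set of substation nodes. Let $s\notin\mathcal{N}$ be an extra node, $\mathcal{N}'=\mathcal{N}\cup\{s\}$, $\mathcal{E}'=\mathcal{E}\cup\{(s,r):r\in\mathcal{R}\}$. The following are given real parameters: $B_w,B_y,N_z\ge 0$; line costs $c_{mn}$; resistances $\phi_{mn}$ and reactances $\eta_{mn}$; flow limits $K_{mn},R_{mn}\ge0$; loads $D^p_{nt},D^q_{nt}\ge 0$; capacities $C^p_n,C^q_n\ge0$; voltage bounds $\nu^{min}\le\nu^{max}$ and reference voltage $V_0>0$; failure-rate bounds $\mu^{max}_{mn,t}\ge 0$; integer minimum restoration times $\tau^{rst}_{mn}$. **First-stage set.** $\mathcal{G}$ is the set of $\mathbf{g}=(\mathbf{y},\mathbf{w},\mathbf{f})$ with $y_{mn}\in\{0,1\}$ and $f_{mn}\ge0$ for $(m,n)\in\mathcal{E}'$, and $w_n\in\{0,1\}$ for $n\in\mathcal{N}$, such that - $\sum_{n:(s,n)\in\mathcal{E}'}f_{sn}=|\mathcal{N}'|-1$; - $\sum_{m:(m,n)\in\mathcal{E}'}f_{mn}-\sum_{m:(n,m)\in\mathcal{E}'}f_{nm}=1$ for all $n\in\mathcal{N}'\setminus\{s\}$; - $\sum_{(m,n)\in\mathcal{E}'}y_{mn}=|\mathcal{N}'|-1$; - $f_{mn}\le(|\mathcal{N}'|-1)y_{mn}$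 for all $(m,n)\in\mathcal{E}'$; - $y_{mn}=1$ for all $(m,n)\in\mathcal{E}'\setminus\mathcal{E}$; - $\sum_{n\in\mathcal{N}}w_n\le B_w$ and $\sum_{(m,n)\in\mathcal{E}}c_{mn}y_{mn}\le B_y$. **Contingency scenarios.** $\mathfrak{D}(\mathbf{g})$ is the set of $\mathbf{z}=(z_{mn,t})\in\{0,1\}^{\mathcal{E}\times\mathcal{T}}$ such that - $\sum_{(m,n)\in\mathcal{E}}(1-z_{mn,t})\le N_z$ for all $t\in\mathcal{T}$; - $1-z_{mn,t}\le y_{mn}$ for all $(m,n)\in\mathcal{E}$, $t\in\mathcal{T}$; - $z_{mn,t+\tau}\le z_{mn,t}$ for all $(m,n)\in\mathcal{E}$ and all integers $1\le\tau\le\tau^{rst}_{mn}$ with $t,t+\tau\in\mathcal{T}$. **Second stage.** $Q(\mathbf{g},\mathbf{z})=\min\sum_{t\in\mathcal{T}}\sum_{n\in\mathcal{N}}s_{nt}$ over $\mathbf{u}=(\mathbf{p},\mathbf{q},\mathbf{x}^p,\mathbf{x}^q,\boldsymbol{\nu},\mathbf{s})\in\mathcal{H}(\mathbf{g},\mathbf{z})$, where $\mathcal{H}(\mathbf{g},\mathbf{z})$ is the set of real vectors $\mathbf{u}$ satisfying, for all $t\in\mathcal{T}$: - $\sum_{k:(n,k)\in\mathcal{E}}p_{nk,t}=\sum_{m:(m,n)\in\mathcal{E}}p_{mn,t}-D^p_{nt}+x^p_{nt}+s_{nt}$ for all $n\in\mathcal{N}$; - $\sum_{k:(n,k)\in\mathcal{E}}q_{nk,t}=\sum_{m:(m,n)\in\mathcal{E}}q_{mn,t}-D^q_{nt}+x^q_{nt}$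 for all $n\in\mathcal{N}$; - $\nu_{nt}y_{mn}=\nu_{mt}y_{mn}-(\phi_{mn}p_{mn,t}+\eta_{mn}q_{mn,t})/V_0$ for all $(m,n)\in\mathcal{E}$; - $\nu^{min}\le\nu_{nt}\le\nu^{max}$ for all $n\in\mathcal{N}$; - $0\le p_{mn,t}\le K_{mn}z_{mn,t}y_{mn}$ and $0\le q_{mn,t}\le R_{mn}z_{mn,t}y_{mn}$ for all $(m,n)\in\mathcal{E}$; - $0\le x^p_{nt}\le C^p_n$ and $0\le x^q_{nt}\le C^q_n$ for $n\in\mathcal{R}$; - $0\le x^p_{nt}\le w_nC^p_n$ and $0\le x^q_{nt}\le w_nC^q_n$ for $n\in\mathcal{N}\setminus\mathcal{R}$; - $0\le s_{nt}\le D^p_{nt}$ for all $n\in\mathcal{N}$. Standing assumption: this minimization is always feasible and bounded, so $Q(\mathbf{g},\mathbf{z})$ is a finite real number for all $\mathbf{g}\in\mathcal{G}$, $\mathbf{z}\in\mathfrak{D}(\mathbf{g})$. **Ambiguity set.** $\mathscr{D}$ (which depends on $\mathbf{g}$) is the set of all probability distributions $\mathbb{P}$ on the finite set $\mathfrak{D}(\mathbf{g})$ such that $0\le E_{\mathbb{P}}[1-z_{mn,t}]\le\mu^{max}_{mn,t}$ for all $(m,n)\in\mathcal{E}$, $t\in\mathcal{T}$. *)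

theory Defs
  imports "HOL-Probability.Probability"
begin

record 'n planning_data =
  num_periods :: nat
  nodes :: "'n set"
  lines :: "('n \<times> 'n) set"
  substations :: "'n set"
  source :: 'n
  budget_w :: real
  budget_y :: real
  max_outages :: real
  line_cost :: "'n \<times> 'n \<Rightarrow> real"
  resistance :: "'n \<times> 'n \<Rightarrow> real"
  reactance :: "'n \<times> 'n \<Rightarrow> real"
  limit_p :: "'n \<times> 'n \<Rightarrow> real"
  limit_q :: "'n \<times> 'n \<Rightarrow> real"
  load_p :: "'n \<times> nat \<Rightarrow> real"
  load_q :: "'n \<times> nat \<Rightarrow> real"
  cap_p :: "'n \<Rightarrow> real"
  cap_q :: "'n \<Rightarrow> real"
  volt_min :: real
  volt_max :: real
  volt_ref :: real
  mu_max :: "('n \<times> 'n) \<times> nat \<Rightarrow> real"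
  restore_time :: "'n \<times> 'n \<Rightarrow> int"

definition periods :: "'n planning_data \<Rightarrow> nat set" where
  "periods I = {1..num_periods I}"

definition nodes' :: "'n planning_data \<Rightarrow> 'n set" where
  "nodes' I = insert (source I) (nodes I)"

definition lines' :: "'n planning_data \<Rightarrow> ('n \<times> 'n) set" where
  "lines' I = lines I \<union> {(source I, r) |r. r \<in> substations I}"

locale planning_instance =
  fixes I :: "'n planning_data"
  assumes finite_nodes: "finite (nodes I)"
    and lines_subset: "lines I \<subseteq> nodes I \<times> nodes I"
    and substations_subset: "substations I \<subseteq> nodes I"
    and source_fresh: "source I \<notin> nodes I"
    and budget_w_nonneg: "0 \<le> budget_w I"
    and budget_y_nonneg: "0 \<le> budget_y I"
    and max_outages_nonneg: "0 \<le> max_outages I"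
    and limit_p_nonneg: "\<And>e. e \<in> lines I \<Longrightarrow> 0 \<le> limit_p I e"
    and limit_q_nonneg: "\<And>e. e \<in> lines I \<Longrightarrow> 0 \<le> limit_q I e"
    and load_p_nonneg: "\<And>n t. n \<in> nodes I \<Longrightarrow> t \<in> periods I \<Longrightarrow> 0 \<le> load_p I (n, t)"
    and load_q_nonneg: "\<And>n t. n \<in> nodes I \<Longrightarrow> t \<in> periods I \<Longrightarrow> 0 \<le> load_q I (n, t)"
    and cap_p_nonneg: "\<And>n. n \<in> nodes I \<Longrightarrow> 0 \<le> cap_p I n"
    and cap_q_nonneg: "\<And>n. n \<in> nodes I \<Longrightarrow> 0 \<le> cap_q I n"
    and volt_bounds: "volt_min I \<le> volt_max I"
    and volt_ref_pos: "0 < volt_ref I"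
    and mu_max_nonneg: "\<And>e t. e \<in> lines I \<Longrightarrow> t \<in> periods I \<Longrightarrow> 0 \<le> mu_max I (e, t)"

text \<open>Vectors over a finite index set are represented by functions that are extensional on
  that set (\<open>\<rightarrow>\<^sub>E\<close>, \<^const>\<open>extensional\<close>), so distinct functions are distinct vectors.\<close>

record 'n first_stage =
  fs_y :: "'n \<times> 'n \<Rightarrow> real"
  fs_w :: "'n \<Rightarrow> real"
  fs_f :: "'n \<times> 'n \<Rightarrow> real"

definition first_stage_set :: "'n planning_data \<Rightarrow> 'n first_stage set" where
  "first_stage_set I = {g.
     fs_y g \<in> lines' I \<rightarrow>\<^sub>E {0, 1} \<and>
     fs_w g \<in> nodes I \<rightarrow>\<^sub>E {0, 1} \<and>
     fs_f g \<in> lines' I \<rightarrow>\<^sub>E {0..} \<and>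
     (\<Sum>n | (source I, n) \<in> lines' I. fs_f g (source I, n)) = real (card (nodes' I)) - 1 \<and>
     (\<forall>n \<in> nodes' I - {source I}.
        (\<Sum>m | (m, n) \<in> lines' I. fs_f g (m, n)) - (\<Sum>m | (n, m) \<in> lines' I. fs_f g (n, m)) = 1) \<and>
     (\<Sum>e \<in> lines' I. fs_y g e) = real (card (nodes' I)) - 1 \<and>
     (\<forall>e \<in> lines' I. fs_f g e \<le> (real (card (nodes' I)) - 1) * fs_y g e) \<and>
     (\<forall>e \<in> lines' I - lines I. fs_y g e = 1) \<and>
     (\<Sum>n \<in> nodes I. fs_w g n) \<le> budget_w I \<and>
     (\<Sum>e \<in> lines I. line_cost I e * fs_y g e) \<le> budget_y I}"

definition scenarios ::
    "'n planning_data \<Rightarrow> 'n first_stage \<Rightarrow> (('n \<times> 'n) \<times> nat \<Rightarrow> real) set" where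
  "scenarios I g = {z \<in> lines I \<times> periods I \<rightarrow>\<^sub>E {0, 1}.
     (\<forall>t \<in> periods I. (\<Sum>e \<in> lines I. 1 - z (e, t)) \<le> max_outages I) \<and>
     (\<forall>e \<in> lines I. \<forall>t \<in> periods I. 1 - z (e, t) \<le> fs_y g e) \<and>
     (\<forall>e \<in> lines I. \<forall>t \<in> periods I. \<forall>\<tau>::nat.
        1 \<le> \<tau> \<and> int \<tau> \<le> restore_time I e \<and> t + \<tau> \<in> periods I \<longrightarrow> z (e, t + \<tau>) \<le> z (e, t))}"

record 'n second_stage =
  ss_p :: "('n \<times> 'n) \<times> nat \<Rightarrow> real"
  ss_q :: "('n \<times> 'n) \<times> nat \<Rightarrow> real"
  ss_xp :: "'n \<times> nat \<Rightarrow> real"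
  ss_xq :: "'n \<times> nat \<Rightarrow> real"
  ss_nu :: "'n \<times> nat \<Rightarrow> real"
  ss_s :: "'n \<times> nat \<Rightarrow> real"

definition second_stage_set ::
    "'n planning_data \<Rightarrow> 'n first_stage \<Rightarrow> (('n \<times> 'n) \<times> nat \<Rightarrow> real) \<Rightarrow> 'n second_stage set" where
  "second_stage_set I g z = {u.
     ss_p u \<in> extensional (lines I \<times> periods I) \<and>
     ss_q u \<in> extensional (lines I \<times> periods I) \<and>
     ss_xp u \<in> extensional (nodes I \<times> periods I) \<and>
     ss_xq u \<in> extensional (nodes I \<times> periods I) \<and>
     ss_nu u \<in> extensional (nodes I \<times> periods I) \<and>
     ss_s u \<in> extensional (nodes I \<times> periods I) \<and>
     (\<forall>t \<in> periods I.
       (\<forall>n \<in> nodes I. (\<Sum>k | (n, k) \<in> lines I. ss_p u ((n, k), t)) =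
          (\<Sum>m | (m, n) \<in> lines I. ss_p u ((m, n), t))
            - load_p I (n, t) + ss_xp u (n, t) + ss_s u (n, t)) \<and>
       (\<forall>n \<in> nodes I. (\<Sum>k | (n, k) \<in> lines I. ss_q u ((n, k), t)) =
          (\<Sum>m | (m, n) \<in> lines I. ss_q u ((m, n), t))
            - load_q I (n, t) + ss_xq u (n, t)) \<and>
       (\<forall>(m, n) \<in> lines I. ss_nu u (n, t) * fs_y g (m, n) =
          ss_nu u (m, t) * fs_y g (m, n)
            - (resistance I (m, n) * ss_p u ((m, n), t)
               + reactance I (m, n) * ss_q u ((m, n), t)) / volt_ref I) \<and>
       (\<forall>n \<in> nodes I. volt_min I \<le> ss_nu u (n, t) \<and> ss_nu u (n, t) \<le> volt_max I) \<and>
       (\<forall>e \<in> lines I.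
          0 \<le> ss_p u (e, t) \<and> ss_p u (e, t) \<le> limit_p I e * z (e, t) * fs_y g e \<and>
          0 \<le> ss_q u (e, t) \<and> ss_q u (e, t) \<le> limit_q I e * z (e, t) * fs_y g e) \<and>
       (\<forall>n \<in> substations I.
          0 \<le> ss_xp u (n, t) \<and> ss_xp u (n, t) \<le> cap_p I n \<and>
          0 \<le> ss_xq u (n, t) \<and> ss_xq u (n, t) \<le> cap_q I n) \<and>
       (\<forall>n \<in> nodes I - substations I.
          0 \<le> ss_xp u (n, t) \<and> ss_xp u (n, t) \<le> fs_w g n * cap_p I n \<and>
          0 \<le> ss_xq u (n, t) \<and> ss_xq u (n, t) \<le> fs_w g n * cap_q I n) \<and>
       (\<forall>n \<in> nodes I. 0 \<le> ss_s u (n, t) \<and> ss_s u (n, t) \<le> load_p I (n, t)))}"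

definition load_shed :: "'n planning_data \<Rightarrow> 'n second_stage \<Rightarrow> real" where
  "load_shed I u = (\<Sum>t \<in> periods I. \<Sum>n \<in> nodes I. ss_s u (n, t))"

definition Q ::
    "'n planning_data \<Rightarrow> 'n first_stage \<Rightarrow> (('n \<times> 'n) \<times> nat \<Rightarrow> real) \<Rightarrow> real" where
  "Q I g z = (LEAST v. v \<in> load_shed I ` second_stage_set I g z)"

definition recourse_feasible_bounded :: "'n planning_data \<Rightarrow> bool" where
  "recourse_feasible_bounded I \<longleftrightarrow>
     (\<forall>g \<in> first_stage_set I. \<forall>z \<in> scenarios I g.
        second_stage_set I g z \<noteq> {} \<and> bdd_below (load_shed I ` second_stage_set I g z))"

text \<open>A probability distribution on the finite set \<open>scenarios I g\<close> is a probability mass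
  function supported in that set.\<close>

definition ambiguity_set ::
    "'n planning_data \<Rightarrow> 'n first_stage \<Rightarrow> (('n \<times> 'n) \<times> nat \<Rightarrow> real) pmf set" where
  "ambiguity_set I g = {P. set_pmf P \<subseteq> scenarios I g \<and>
     (\<forall>e \<in> lines I. \<forall>t \<in> periods I.
        0 \<le> measure_pmf.expectation P (\<lambda>z. 1 - z (e, t)) \<and>
        measure_pmf.expectation P (\<lambda>z. 1 - z (e, t)) \<le> mu_max I (e, t))}"

definition dual_objective ::
    "'n planning_data \<Rightarrow> 'n first_stage \<Rightarrow> (('n \<times> 'n) \<times> nat \<Rightarrow> real) \<Rightarrow> real" where
  "dual_objective I g \<beta> =
     Max ((\<lambda>z. Q I g z +
             (\<Sum>t \<in> periods I. \<Sum>e \<in> lines I. (mu_max I (e, t) + z (e, t) - 1) * \<beta> (e, t)))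
          ` scenarios I g)"

lemma compact_box:
  "compact (extensional A \<inter> {f :: 'i \<Rightarrow> real. \<forall>i\<in>A. lo i \<le> f i \<and> f i \<le> hi i})"
proof -
  let ?B = "\<lambda>i. if i \<in> A then {lo i..hi i} else {undefined}"
  have "compactin (product_topology (\<lambda>i. euclidean) UNIV) (PiE UNIV ?B)"
    unfolding compactin_PiE by simp
  moreover have "PiE UNIV ?B = extensional A \<inter> {f. \<forall>i\<in>A. lo i \<le> f i \<and> f i \<le> hi i}"
    by (auto simp: PiE_iff extensional_def split: if_splits)
  ultimately show ?thesis
    unfolding euclidean_product_topology by simp
qed

lemma continuous_on_coordinate [continuous_intros]:
  fixes f :: "'a::topological_space \<Rightarrow> 'b \<Rightarrow> real"
  shows "continuous_on S f \<Longrightarrow> continuous_on S (\<lambda>x. f x i)"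
  by (rule continuous_on_product_then_coordinatewise)

context planning_instance
begin

lemma finite_lines: "finite (lines I)"
  using finite_nodes lines_subset by (meson finite_SigmaI finite_subset)

lemma finite_scenarios: "finite (scenarios I g)"
  unfolding scenarios_def periods_def
  by (rule finite_subset[OF Collect_restrict]) (intro finite_PiE, auto simp: finite_lines)

lemma scenarios_nonempty:
  assumes "g \<in> first_stage_set I"
  shows "scenarios I g \<noteq> {}"
proof -
  have "fs_y g e \<ge> 0" if "e \<in> lines I" for e
  proof -
    have "fs_y g \<in> lines' I \<rightarrow>\<^sub>E {0, 1}" "e \<in> lines' I"
      using assms that by (auto simp: first_stage_set_def lines'_def)
    then have "fs_y g e \<in> {0, 1}" by (rule PiE_mem)
    then show ?thesis by auto
  qed
  then have "restrict (\<lambda>_. 1) (lines I \<times> periods I) \<in> scenarios I g"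
    using max_outages_nonneg by (auto simp: scenarios_def)
  then show ?thesis by blast
qed

text \<open>The minimum in \<^const>\<open>Q\<close> exists: the feasible set is compact.\<close>

lemma Q_attained:
  assumes "second_stage_set I g z \<noteq> {}"
  shows "\<exists>u \<in> second_stage_set I g z. Q I g z = load_shed I u \<and>
           (\<forall>u' \<in> second_stage_set I g z. load_shed I u \<le> load_shed I u')"
proof -
  let ?E = "lines I \<times> periods I" and ?N = "nodes I \<times> periods I"
  define mk where "mk = (\<lambda>(p, q, a, b, v, s).
      \<lparr>ss_p = p, ss_q = q, ss_xp = a, ss_xq = b, ss_nu = v, ss_s = s\<rparr> :: 'n second_stage)"
  define tp where "tp u = (ss_p u, ss_q u, ss_xp u, ss_xq u, ss_nu u, ss_s u)"
    for u :: "'n second_stage"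
  have mk_tp: "mk (tp u) = u" for u by (simp add: mk_def tp_def)
  define B where "B = (extensional ?E \<inter>
        {f. \<forall>i\<in>?E. (0::real) \<le> f i \<and> f i \<le> limit_p I (fst i) * z i * fs_y g (fst i)})
    \<times> (extensional ?E \<inter>
        {f. \<forall>i\<in>?E. (0::real) \<le> f i \<and> f i \<le> limit_q I (fst i) * z i * fs_y g (fst i)})
    \<times> (extensional ?N \<inter>
        {f. \<forall>i\<in>?N. (0::real) \<le> f i \<and> f i \<le>
          (if fst i \<in> substations I then 1 else fs_w g (fst i)) * cap_p I (fst i)})
    \<times> (extensional ?N \<inter>
        {f. \<forall>i\<in>?N. (0::real) \<le> f i \<and> f i \<le>
          (if fst i \<in> substations I then 1 else fs_w g (fst i)) * cap_q I (fst i)})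
    \<times> (extensional ?N \<inter>
        {f. \<forall>i\<in>?N. volt_min I \<le> f i \<and> f i \<le> volt_max I})
    \<times> (extensional ?N \<inter>
        {f. \<forall>i\<in>?N. (0::real) \<le> f i \<and> f i \<le> load_p I i})"
  have cB: "compact B" unfolding B_def by (intro compact_Times compact_box)
  define C where "C = {x. mk x \<in> second_stage_set I g z}"
  have clC: "closed C"
    unfolding C_def second_stage_set_def mk_def case_prod_unfold Ball_def extensional_def mem_Collect_eq
      second_stage.simps divide_inverse
    by (intro closed_Collect_all closed_Collect_conj closed_Collect_imp open_Collect_const
        closed_Collect_eq closed_Collect_le continuous_intros)
  have CB: "C \<subseteq> B"
  proof
    fix x assume x: "x \<in> C"
    obtain p q a b v s where xx: "x = (p, q, a, b, v, s)" by (cases x) auto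
    define u where "u = mk x"
    have u: "u \<in> second_stage_set I g z" using x by (simp add: C_def u_def)
    have f: "ss_p u = p" "ss_q u = q" "ss_xp u = a" "ss_xq u = b" "ss_nu u = v" "ss_s u = s"
      by (simp_all add: u_def mk_def xx)
    show "x \<in> B"
      unfolding B_def xx using u[unfolded second_stage_set_def mem_Collect_eq f]
      by (intro SigmaI IntI CollectI ballI; (elim SigmaE)?; simp)
  qed
  then have eq: "C = B \<inter> C" by blast
  have "compact (B \<inter> C)" using cB clC by (rule compact_Int_closed)
  moreover have "B \<inter> C \<noteq> {}"
  proof -
    obtain u where "u \<in> second_stage_set I g z" using assms by blast
    then have "tp u \<in> C" by (simp add: mk_tp C_def)
    then show ?thesis using eq by blast
  qed
  moreover have "continuous_on (B \<inter> C) (\<lambda>x. load_shed I (mk x))"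
    unfolding load_shed_def mk_def case_prod_unfold second_stage.simps by (intro continuous_intros)
  ultimately obtain x where x: "x \<in> B \<inter> C"
    "\<forall>y \<in> B \<inter> C. load_shed I (mk x) \<le> load_shed I (mk y)"
    using continuous_attains_inf by blast
  have m: "mk x \<in> second_stage_set I g z" using x(1) by (simp add: C_def)
  have le: "load_shed I (mk x) \<le> load_shed I u'" if "u' \<in> second_stage_set I g z" for u'
  proof -
    have "tp u' \<in> B \<inter> C" using that eq by (auto simp: mk_tp C_def)
    then have "load_shed I (mk x) \<le> load_shed I (mk (tp u'))" using x(2) by blast
    then show ?thesis by (simp add: mk_tp)
  qed
  have "Q I g z = load_shed I (mk x)"
    unfolding Q_def by (rule Least_equality) (use m le in auto)
  then show ?thesis using m le by blast
qed

end

end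

(* Write q for the recourse cost Q and c for the moment functions 1 - z, and pass to
   unnormalized weights x on the scenarios. If v is the optimal value of the moment
   problem, then x \<ge> 0 together with the homogenized moment constraints
   sum (mu - c) x \<ge> 0 implies sum (v - q) x \<ge> 0. The finite Farkas lemma writes
   v - q as a nonnegative combination of these constraints, and the coefficients of the moment
   constraints are an optimal beta. Being purely polyhedral, the argument needs no Slater
   point, so mu = 0 is allowed. *)
theory Submission
  imports Defs
begin

section \<open>Finite Farkas lemma\<close>

(* Induction on the constraints: a point x0 that violates the conclusion but satisfies all
   constraints except k is used to project onto the hyperplane on which k vanishes. *)
lemma farkas_finite:
  fixes a :: "'i \<Rightarrow> 'z \<Rightarrow> real" and b :: "'z \<Rightarrow> real"
  assumes "finite S"
    and "\<And>x. (\<And>i. i \<in> S \<Longrightarrow> 0 \<le> (\<Sum>z\<in>Z. a i z * x z)) \<Longrightarrow> 0 \<le> (\<Sum>z\<in>Z. b z * x z)"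
    and "finite Z"
  shows "\<exists>\<kappa>. (\<forall>i\<in>S. 0 \<le> \<kappa> i) \<and> (\<forall>z\<in>Z. b z = (\<Sum>i\<in>S. \<kappa> i * a i z))"
  using assms(1,2)
proof (induction S arbitrary: a b rule: finite_induct)
  case empty
  \<comment> \<open>With no constraints every vector is admissible; testing with \<open>- b\<close>
    forces \<open>b\<close> to vanish on \<open>Z\<close>.\<close>
  have "0 \<le> (\<Sum>z\<in>Z. b z * (- b z))"
    by (rule empty.prems) simp
  then have "(\<Sum>z\<in>Z. b z * b z) \<le> 0"
    by (simp add: sum_negf)
  then have "(\<Sum>z\<in>Z. b z * b z) = 0"
    by (intro antisym sum_nonneg) auto
  then show ?case
    using \<open>finite Z\<close> by (simp add: sum_nonneg_eq_0_iff)
next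
  case (insert k S)
  show ?case
  proof (cases "\<forall>x. (\<forall>i\<in>S. 0 \<le> (\<Sum>z\<in>Z. a i z * x z)) \<longrightarrow> 0 \<le> (\<Sum>z\<in>Z. b z * x z)")
    case True
    then obtain \<kappa> where \<kappa>: "\<forall>i\<in>S. 0 \<le> \<kappa> i" "\<forall>z\<in>Z. b z = (\<Sum>i\<in>S. \<kappa> i * a i z)"
      using insert.IH[of a b] by blast
    have "(\<Sum>i\<in>S. (\<kappa>(k := 0)) i * a i z) = (\<Sum>i\<in>S. \<kappa> i * a i z)" for z
      using insert.hyps by (intro sum.cong) auto
    with \<kappa> insert.hyps show ?thesis
      by (intro exI[of _ "\<kappa>(k := 0)"]) auto
  next
    case False
    then obtain x1 where x1: "\<And>i. i \<in> S \<Longrightarrow> 0 \<le> (\<Sum>z\<in>Z. a i z * x1 z)"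
      "(\<Sum>z\<in>Z. b z * x1 z) < 0"
      by force
    define d where "d = - (\<Sum>z\<in>Z. a k z * x1 z)"
    \<comment> \<open>Otherwise \<open>x1\<close> would satisfy constraint \<open>k\<close> as well,
      and the hypothesis would contradict its choice. Dividing by \<open>d\<close> normalizes the
      value of constraint \<open>k\<close> at \<open>x0\<close> to -1.\<close>
    have "d > 0"
      using insert.prems[of x1] x1 unfolding d_def by force
    define x0 where "x0 z = x1 z / d" for z
    have scale: "(\<Sum>z\<in>Z. h z * x0 z) = (\<Sum>z\<in>Z. h z * x1 z) / d" for h
      by (simp add: x0_def sum_divide_distrib)
    define A where "A i = (\<Sum>z\<in>Z. a i z * x0 z)" for i
    define B where "B = (\<Sum>z\<in>Z. b z * x0 z)"
    have Ak: "A k = -1"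
      using \<open>d > 0\<close> unfolding A_def scale by (simp add: d_def)
    have A: "0 \<le> A i" if "i \<in> S" for i
      using x1(1)[OF that] \<open>d > 0\<close> by (simp add: A_def scale)
    have B: "B < 0"
      using x1(2) \<open>d > 0\<close> by (simp add: B_def scale divide_neg_pos)
    \<comment> \<open>\<open>a' i\<close> and \<open>b'\<close> are \<open>a i\<close> and
      \<open>b\<close> composed with the projection along \<open>x0\<close> that sends
      \<open>x\<close> to \<open>x + (a k . x) x0\<close>; \<open>proj\<close> is this
      identity.\<close>
    define a' where "a' i z = a i z + A i * a k z" for i z
    define b' where "b' z = b z + B * a k z" for z
    have proj: "(\<Sum>z\<in>Z. (h z + (\<Sum>z\<in>Z. h z * x0 z) * a k z) * x z)
        = (\<Sum>z\<in>Z. h z * (x z + (\<Sum>z\<in>Z. a k z * x z) * x0 z))" for h x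
      by (simp add: algebra_simps sum.distrib sum_distrib_left sum_distrib_right)
         (subst sum.swap, simp add: mult_ac)
    have "0 \<le> (\<Sum>z\<in>Z. b' z * x z)" if nonneg: "\<And>i. i \<in> S \<Longrightarrow> 0 \<le> (\<Sum>z\<in>Z. a' i z * x z)" for x
    proof -
      let ?y = "\<lambda>z. x z + (\<Sum>z\<in>Z. a k z * x z) * x0 z"
      have "(\<Sum>z\<in>Z. a k z * ?y z) = (\<Sum>z\<in>Z. (a k z + A k * a k z) * x z)"
        using proj[of "a k" x] by (simp add: A_def)
      then have "(\<Sum>z\<in>Z. a k z * ?y z) = 0"
        by (simp add: Ak)
      moreover have "0 \<le> (\<Sum>z\<in>Z. a i z * ?y z)" if "i \<in> S" for i
        using nonneg[OF that] proj[of "a i" x] by (simp add: a'_def A_def)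
      ultimately have "0 \<le> (\<Sum>z\<in>Z. b z * ?y z)"
        by (intro insert.prems) auto
      then show ?thesis
        using proj[of b x] by (simp add: b'_def B_def)
    qed
    then obtain \<kappa> where \<kappa>: "\<And>i. i \<in> S \<Longrightarrow> 0 \<le> \<kappa> i"
      "\<And>z. z \<in> Z \<Longrightarrow> b' z = (\<Sum>i\<in>S. \<kappa> i * a' i z)"
      using insert.IH[of a' b'] by blast
    \<comment> \<open>Expanding \<open>b' = \<Sum> \<kappa> i * a' i\<close> and solving for
      \<open>b\<close> leaves this coefficient on \<open>a k\<close>; it is nonnegative because
      \<open>A i \<ge> 0\<close> and \<open>B < 0\<close>.\<close>
    define \<kappa>' where "\<kappa>' = \<kappa>(k := (\<Sum>i\<in>S. \<kappa> i * A i) - B)"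
    have "0 \<le> (\<Sum>i\<in>S. \<kappa> i * A i)"
      using \<kappa>(1) A by (intro sum_nonneg) simp
    then have "\<forall>i\<in>insert k S. 0 \<le> \<kappa>' i"
      using \<kappa>(1) B by (auto simp: \<kappa>'_def)
    moreover have "b z = (\<Sum>i\<in>insert k S. \<kappa>' i * a i z)" if "z \<in> Z" for z
    proof -
      have "(\<Sum>i\<in>S. \<kappa>' i * a i z) = (\<Sum>i\<in>S. \<kappa> i * a i z)"
        using insert.hyps by (intro sum.cong) (auto simp: \<kappa>'_def)
      then have "(\<Sum>i\<in>insert k S. \<kappa>' i * a i z)
          = ((\<Sum>i\<in>S. \<kappa> i * A i) - B) * a k z + (\<Sum>i\<in>S. \<kappa> i * a i z)"
        using insert.hyps by (simp add: \<kappa>'_def)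
      also have "\<dots> = (\<Sum>i\<in>S. \<kappa> i * a' i z) - B * a k z"
        by (simp add: a'_def algebra_simps sum.distrib sum_distrib_left)
      also have "\<dots> = b z"
        using \<kappa>(2)[OF that] by (simp add: b'_def)
      finally show ?thesis by simp
    qed
    ultimately show ?thesis by blast
  qed
qed

section \<open>Moment problems on a finite set: attainment and duality\<close>

lemma pmf_of_weights:
  fixes x :: "'z \<Rightarrow> real"
  assumes "finite Z" "\<And>z. z \<in> Z \<Longrightarrow> 0 \<le> x z" "sum x Z = 1"
  obtains P where "set_pmf P \<subseteq> Z" "\<And>z. z \<in> Z \<Longrightarrow> pmf P z = x z"
proof
  \<comment> \<open>\<open>x\<close> is arbitrary outside \<open>Z\<close>, whereas
    \<open>embed_pmf\<close> expects a density on the whole type.\<close>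
  define w where "w z = (if z \<in> Z then x z else 0)" for z
  have nn: "0 \<le> w z" for z
    using assms(2) by (simp add: w_def)
  have "(\<integral>\<^sup>+ z. ennreal (w z) \<partial>count_space UNIV) = (\<Sum>z\<in>Z. ennreal (w z))"
    using assms(1) by (intro nn_integral_count_space'[where A = Z]) (auto simp: w_def)
  also have "\<dots> = ennreal (\<Sum>z\<in>Z. w z)"
    using nn by (simp add: sum_ennreal)
  also have "(\<Sum>z\<in>Z. w z) = 1"
    using assms(3) by (simp add: w_def)
  finally have tot: "(\<integral>\<^sup>+ z. ennreal (w z) \<partial>count_space UNIV) = 1" by simp
  have eq: "pmf (embed_pmf w) z = w z" for z
    using nn tot by (intro pmf_embed_pmf) auto
  show "set_pmf (embed_pmf w) \<subseteq> Z"
    by (auto simp: set_pmf_iff eq w_def split: if_splits)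
  show "pmf (embed_pmf w) z = x z" if "z \<in> Z" for z
    using that by (simp add: eq w_def)
qed

text \<open>The duality argument is carried out for this abstract problem; the planning instance
  takes \<open>c j z = 1 - z j\<close>, with \<open>j\<close> a line-period pair.\<close>

definition moment_pmfs ::
    "'z set \<Rightarrow> 'j set \<Rightarrow> ('j \<Rightarrow> 'z \<Rightarrow> real) \<Rightarrow> ('j \<Rightarrow> real) \<Rightarrow> 'z pmf set" where
  "moment_pmfs Z J c \<mu> =
     {P. set_pmf P \<subseteq> Z \<and> (\<forall>j\<in>J. measure_pmf.expectation P (c j) \<le> \<mu> j)}"

lemma expectation_finite_support:
  fixes f :: "'z \<Rightarrow> real"
  assumes "finite Z" "set_pmf P \<subseteq> Z"
  shows "measure_pmf.expectation P f = (\<Sum>z\<in>Z. f z * pmf P z)"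
  using assms by (intro integral_measure_pmf_real) auto

text \<open>In terms of weight vectors, a linear objective is maximized over a nonempty compact
  set.\<close>

lemma moment_problem_attained:
  fixes q :: "'z \<Rightarrow> real"
  assumes fin: "finite Z" and ne: "moment_pmfs Z J c \<mu> \<noteq> {}"
  obtains P where "P \<in> moment_pmfs Z J c \<mu>"
    "\<And>P'. P' \<in> moment_pmfs Z J c \<mu> \<Longrightarrow>
       measure_pmf.expectation P' q \<le> measure_pmf.expectation P q"
proof -
  \<comment> \<open>Fixing the values outside \<open>Z\<close> by extensionality makes the box
    compact in the product topology on all functions.\<close>
  let ?box = "extensional Z \<inter> {x. \<forall>z\<in>Z. (0::real) \<le> x z \<and> x z \<le> 1}"
  let ?C = "{x. (\<Sum>z\<in>Z. x z) = 1 \<and> (\<forall>j. j \<in> J \<longrightarrow> (\<Sum>z\<in>Z. c j z * x z) \<le> \<mu> j)}"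
  define K where "K = ?box \<inter> ?C"
  have "closed ?C"
    by (intro closed_Collect_all closed_Collect_conj closed_Collect_imp open_Collect_const
        closed_Collect_eq closed_Collect_le continuous_intros)
  then have "compact K"
    unfolding K_def by (rule compact_Int_closed[OF compact_box])
  have weights: "restrict (pmf P) Z \<in> K"
    "measure_pmf.expectation P q = (\<Sum>z\<in>Z. q z * restrict (pmf P) Z z)"
    if "P \<in> moment_pmfs Z J c \<mu>" for P
    using that fin
    by (auto simp: K_def moment_pmfs_def expectation_finite_support sum_pmf_eq_1 pmf_le_1)
  have "K \<noteq> {}"
    using weights(1) ne by blast
  moreover have "continuous_on K (\<lambda>x. \<Sum>z\<in>Z. q z * x z)"
    by (intro continuous_intros)
  ultimately obtain x where x: "x \<in> K"
    "\<And>y. y \<in> K \<Longrightarrow> (\<Sum>z\<in>Z. q z * y z) \<le> (\<Sum>z\<in>Z. q z * x z)"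
    using continuous_attains_sup[OF \<open>compact K\<close>] by blast
  from x(1) obtain P where P: "set_pmf P \<subseteq> Z" "\<And>z. z \<in> Z \<Longrightarrow> pmf P z = x z"
    using pmf_of_weights[OF fin, of x] by (auto simp: K_def)
  have E: "measure_pmf.expectation P f = (\<Sum>z\<in>Z. f z * x z)" for f :: "'z \<Rightarrow> real"
    using P by (simp add: expectation_finite_support[OF fin])
  show thesis
  proof
    show "P \<in> moment_pmfs Z J c \<mu>"
      using x(1) P(1) by (auto simp: moment_pmfs_def E K_def)
    show "measure_pmf.expectation P' q \<le> measure_pmf.expectation P q"
      if "P' \<in> moment_pmfs Z J c \<mu>" for P'
      using x(2)[OF weights(1)[OF that]] weights(2)[OF that] by (simp add: E)
  qed
qed

text \<open>Strong half of the duality: rescaling a nonzero weight vector to total mass 1 turns the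
  bound on expectations into the implication between homogeneous inequalities that Farkas
  requires.\<close>

lemma moment_dual_certificate:
  fixes q :: "'z \<Rightarrow> real" and c :: "'j \<Rightarrow> 'z \<Rightarrow> real"
  assumes fin: "finite Z" "finite J"
    and bound: "\<And>P. P \<in> moment_pmfs Z J c \<mu> \<Longrightarrow> measure_pmf.expectation P q \<le> v"
  obtains \<beta> where "\<And>j. j \<in> J \<Longrightarrow> 0 \<le> \<beta> j"
    "\<And>z. z \<in> Z \<Longrightarrow> q z + (\<Sum>j\<in>J. (\<mu> j - c j z) * \<beta> j) \<le> v"
proof -
  \<comment> \<open>The left summand encodes the sign constraints \<open>x y \<ge> 0\<close>, the
    right one the homogenized moment constraints.\<close>
  define a where "a = case_sum (\<lambda>y z. if z = y then 1 else 0 :: real) (\<lambda>j z. \<mu> j - c j z)"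
  have key: "0 \<le> (\<Sum>z\<in>Z. (v - q z) * x z)"
    if con: "\<And>i. i \<in> Z <+> J \<Longrightarrow> 0 \<le> (\<Sum>z\<in>Z. a i z * x z)" for x
  proof -
    have x_nn: "0 \<le> x z" if "z \<in> Z" for z
      using con[OF InlI[OF that]] that fin by (simp add: a_def mult_delta_left)
    have mom: "0 \<le> (\<Sum>z\<in>Z. (\<mu> j - c j z) * x z)" if "j \<in> J" for j
      using con[OF InrI[OF that]] by (simp add: a_def)
    define s where "s = sum x Z"
    show ?thesis
    \<comment> \<open>Zero mass cannot be normalized, but nonnegative weights of total 0 all
      vanish.\<close>
    proof (cases "s = 0")
      case True
      then have "\<forall>z\<in>Z. x z = 0"
        using x_nn fin by (simp add: s_def sum_nonneg_eq_0_iff)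
      then show ?thesis by simp
    next
      case False
      then have "s > 0"
        using x_nn by (simp add: s_def sum_nonneg less_le)
      then have "(\<Sum>z\<in>Z. x z / s) = 1"
        by (simp add: s_def flip: sum_divide_distrib)
      then obtain P where P: "set_pmf P \<subseteq> Z" "\<And>z. z \<in> Z \<Longrightarrow> pmf P z = x z / s"
        using pmf_of_weights[OF fin(1), of "\<lambda>z. x z / s"] x_nn \<open>s > 0\<close> by auto
      have E: "measure_pmf.expectation P f = (\<Sum>z\<in>Z. f z * x z) / s" for f :: "'z \<Rightarrow> real"
        using P by (simp add: expectation_finite_support[OF fin(1)] sum_divide_distrib)
      have slack: "(\<Sum>z\<in>Z. (r - f z) * x z) = r * s - (\<Sum>z\<in>Z. f z * x z)"
        for r and f :: "'z \<Rightarrow> real"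
        by (simp add: s_def left_diff_distrib sum_subtractf sum_distrib_left)
      have "P \<in> moment_pmfs Z J c \<mu>"
        using P(1) mom \<open>s > 0\<close> by (auto simp: moment_pmfs_def E slack divide_le_eq)
      from bound[OF this] show ?thesis
        using \<open>s > 0\<close> by (simp add: E slack divide_le_eq)
    qed
  qed
  have "\<exists>\<kappa>. (\<forall>i\<in>Z <+> J. 0 \<le> \<kappa> i) \<and> (\<forall>z\<in>Z. v - q z = (\<Sum>i\<in>Z <+> J. \<kappa> i * a i z))"
  proof (rule farkas_finite)
    show "finite (Z <+> J)" "finite Z" using fin by simp_all
  qed (rule key)
  then obtain \<kappa> where \<kappa>: "\<forall>i\<in>Z <+> J. 0 \<le> \<kappa> i"
    "\<forall>z\<in>Z. v - q z = (\<Sum>i\<in>Z <+> J. \<kappa> i * a i z)"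
    by (elim exE conjE)
  show thesis
  proof
    show "0 \<le> \<kappa> (Inr j)" if "j \<in> J" for j
      by (rule bspec[OF \<kappa>(1) InrI[OF that]])
    show "q z + (\<Sum>j\<in>J. (\<mu> j - c j z) * \<kappa> (Inr j)) \<le> v" if "z \<in> Z" for z
    proof -
      \<comment> \<open>Of the sign constraints only the one at \<open>z\<close> contributes; its
        nonnegative multiplier is the slack of the dual inequality.\<close>
      have "v - q z = \<kappa> (Inl z) + (\<Sum>j\<in>J. (\<mu> j - c j z) * \<kappa> (Inr j))"
        using bspec[OF \<kappa>(2) that] that fin
        by (simp add: sum.Plus a_def mult_delta_right mult.commute)
      with bspec[OF \<kappa>(1) InlI[OF that]] show ?thesis by simp
    qed
  qed
qed

text \<open>Adding the nonnegative penalty \<open>\<Sum> \<beta> j * (\<mu> j - E (c j))\<close> to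
  the expectation of \<open>q\<close> gives an average of quantities bounded by
  \<open>v\<close>.\<close>

lemma moment_weak_duality:
  fixes q :: "'z \<Rightarrow> real" and c :: "'j \<Rightarrow> 'z \<Rightarrow> real"
  assumes fin: "finite Z" and P: "P \<in> moment_pmfs Z J c \<mu>"
    and nonneg: "\<And>j. j \<in> J \<Longrightarrow> 0 \<le> \<beta> j"
    and bound: "\<And>z. z \<in> Z \<Longrightarrow> q z + (\<Sum>j\<in>J. (\<mu> j - c j z) * \<beta> j) \<le> v"
  shows "measure_pmf.expectation P q \<le> v"
proof -
  have supp: "set_pmf P \<subseteq> Z" using P by (simp add: moment_pmfs_def)
  note E = expectation_finite_support[OF fin supp]
  have one: "(\<Sum>z\<in>Z. pmf P z) = 1"
    using fin supp by (simp add: sum_pmf_eq_1)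
  have "0 \<le> (\<Sum>j\<in>J. \<beta> j * (\<mu> j - (\<Sum>z\<in>Z. c j z * pmf P z)))"
    using P nonneg by (intro sum_nonneg mult_nonneg_nonneg) (auto simp: moment_pmfs_def E)
  also have "\<dots> = (\<Sum>j\<in>J. \<Sum>z\<in>Z. (\<mu> j - c j z) * \<beta> j * pmf P z)"
  proof (rule sum.cong[OF refl])
    fix j
    have "\<mu> j - (\<Sum>z\<in>Z. c j z * pmf P z) = (\<Sum>z\<in>Z. (\<mu> j - c j z) * pmf P z)"
      by (simp add: left_diff_distrib sum_subtractf one flip: sum_distrib_left)
    then show "\<beta> j * (\<mu> j - (\<Sum>z\<in>Z. c j z * pmf P z))
        = (\<Sum>z\<in>Z. (\<mu> j - c j z) * \<beta> j * pmf P z)"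
      by (simp add: sum_distrib_left mult_ac)
  qed
  also have "\<dots> = (\<Sum>z\<in>Z. (\<Sum>j\<in>J. (\<mu> j - c j z) * \<beta> j) * pmf P z)"
    by (subst sum.swap) (simp add: sum_distrib_right)
  finally have "measure_pmf.expectation P q
      \<le> (\<Sum>z\<in>Z. (q z + (\<Sum>j\<in>J. (\<mu> j - c j z) * \<beta> j)) * pmf P z)"
    by (simp add: E distrib_right sum.distrib)
  also have "\<dots> \<le> (\<Sum>z\<in>Z. v * pmf P z)"
    using bound by (intro sum_mono mult_right_mono) auto
  also have "\<dots> = v"
    by (simp add: one flip: sum_distrib_left)
  finally show ?thesis .
qed

section \<open>Specialization to the planning instance\<close>

lemma scenario_le_1:
  assumes "z \<in> scenarios I g" "e \<in> lines I" "t \<in> periods I"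
  shows "z (e, t) \<le> 1"
proof -
  have "z \<in> lines I \<times> periods I \<rightarrow>\<^sub>E {0, 1}" "(e, t) \<in> lines I \<times> periods I"
    using assms by (simp_all add: scenarios_def)
  then have "z (e, t) \<in> {0, 1}" by (rule PiE_mem)
  then show ?thesis by auto
qed

context planning_instance
begin

text \<open>Since \<open>1 - z (e, t)\<close> is nonnegative on scenarios, every distribution
  supported there meets the lower moment bounds.\<close>

lemma ambiguity_set_eq_moment_pmfs:
  "ambiguity_set I g =
     moment_pmfs (scenarios I g) (lines I \<times> periods I) (\<lambda>j z. 1 - z j) (mu_max I)"
proof -
  have "0 \<le> measure_pmf.expectation P (\<lambda>z. 1 - z (e, t))"
    if "set_pmf P \<subseteq> scenarios I g" "e \<in> lines I" "t \<in> periods I" for P e t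
    using that by (subst expectation_finite_support[OF finite_scenarios])
      (auto intro!: sum_nonneg mult_nonneg_nonneg simp: scenario_le_1)
  then show ?thesis
    by (auto simp: ambiguity_set_def moment_pmfs_def)
qed

text \<open>A maximum over a finite nonempty set is bounded pointwise; the double sum is flattened
  to match the abstract moment problem.\<close>

lemma dual_objective_le_iff:
  assumes "g \<in> first_stage_set I"
  shows "dual_objective I g \<beta> \<le> v \<longleftrightarrow>
    (\<forall>z \<in> scenarios I g.
       Q I g z + (\<Sum>j \<in> lines I \<times> periods I. (mu_max I j - (1 - z j)) * \<beta> j) \<le> v)"
proof -
  have "(\<Sum>t \<in> periods I. \<Sum>e \<in> lines I. (mu_max I (e, t) + z (e, t) - 1) * \<beta> (e, t))
      = (\<Sum>j \<in> lines I \<times> periods I. (mu_max I j - (1 - z j)) * \<beta> j)" for z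
    by (subst sum.swap) (auto simp: sum.cartesian_product algebra_simps intro!: sum.cong)
  then show ?thesis
    using finite_scenarios scenarios_nonempty[OF assms]
    by (simp add: dual_objective_def)
qed

text \<open>The witness is the point mass at the outage-free scenario, whose moments are all
  0.\<close>

lemma ambiguity_set_nonempty:
  assumes "g \<in> first_stage_set I"
  shows "ambiguity_set I g \<noteq> {}"
proof -
  let ?z = "restrict (\<lambda>_. 1) (lines I \<times> periods I)"
  have "0 \<le> fs_y g e" if "e \<in> lines I" for e
  proof -
    have "fs_y g \<in> lines' I \<rightarrow>\<^sub>E {0, 1}" "e \<in> lines' I"
      using assms that by (auto simp: first_stage_set_def lines'_def)
    then have "fs_y g e \<in> {0, 1}" by (rule PiE_mem)
    then show ?thesis by auto
  qed
  then have "?z \<in> scenarios I g"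
    using max_outages_nonneg by (auto simp: scenarios_def)
  then have "return_pmf ?z \<in> ambiguity_set I g"
    using mu_max_nonneg by (auto simp: ambiguity_set_def)
  then show ?thesis by blast
qed

end

theorem proposition1:
  fixes I :: "'n planning_data" and g :: "'n first_stage"
  assumes "planning_instance I"
    and "recourse_feasible_bounded I"
    and "g \<in> first_stage_set I"
  shows "\<exists>P \<beta>.
      is_arg_max (\<lambda>P. measure_pmf.expectation P (Q I g)) (\<lambda>P. P \<in> ambiguity_set I g) P \<and>
      is_arg_min (dual_objective I g) (\<lambda>\<beta>. \<beta> \<in> lines I \<times> periods I \<rightarrow>\<^sub>E {0..}) \<beta> \<and>
      measure_pmf.expectation P (Q I g) = dual_objective I g \<beta>"
proof -
  interpret planning_instance I by fact
  let ?Z = "scenarios I g" and ?J = "lines I \<times> periods I"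
  have finJ: "finite ?J"
    by (simp add: finite_lines periods_def)
  note amb = ambiguity_set_eq_moment_pmfs
  note dual_le = dual_objective_le_iff[OF assms(3)]
  obtain P where P: "P \<in> ambiguity_set I g"
    and max: "\<And>P'. P' \<in> ambiguity_set I g \<Longrightarrow>
      measure_pmf.expectation P' (Q I g) \<le> measure_pmf.expectation P (Q I g)"
    using moment_problem_attained[OF finite_scenarios] ambiguity_set_nonempty[OF assms(3)]
    unfolding amb by blast
  \<comment> \<open>The certificate is taken at \<open>v\<close> equal to the attained primal
    optimum.\<close>
  obtain \<beta> where \<beta>: "\<And>j. j \<in> ?J \<Longrightarrow> 0 \<le> \<beta> j"
    "\<And>z. z \<in> ?Z \<Longrightarrow> Q I g z + (\<Sum>j\<in>?J. (mu_max I j - (1 - z j)) * \<beta> j)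
       \<le> measure_pmf.expectation P (Q I g)"
    using moment_dual_certificate[OF finite_scenarios finJ max[unfolded amb]] by blast
  \<comment> \<open>The certificate is unconstrained off \<open>?J\<close>; restricting it yields an
    extensional vector with the same penalty sums.\<close>
  let ?\<beta> = "restrict \<beta> ?J"
  \<comment> \<open>Weak duality with \<open>v\<close> the dual value of \<open>\<beta>'\<close>
    itself. It serves twice: to close the gap at \<open>?\<beta>\<close>, and to show that
    \<open>?\<beta>\<close> is a minimizer.\<close>
  have weak: "measure_pmf.expectation P (Q I g) \<le> dual_objective I g \<beta>'"
    if "\<beta>' \<in> ?J \<rightarrow>\<^sub>E {0..}" for \<beta>'
  proof (rule moment_weak_duality[OF finite_scenarios P[unfolded amb]])
    show "0 \<le> \<beta>' j" if "j \<in> ?J" for j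
      using PiE_mem[OF \<open>\<beta>' \<in> _\<close> that] by simp
    show "Q I g z + (\<Sum>j\<in>?J. (mu_max I j - (1 - z j)) * \<beta>' j) \<le> dual_objective I g \<beta>'"
      if "z \<in> ?Z" for z
      using dual_le[of \<beta>' "dual_objective I g \<beta>'"] that by blast
  qed
  have mem: "?\<beta> \<in> ?J \<rightarrow>\<^sub>E {0..}"
    using \<beta>(1) by auto
  have "dual_objective I g ?\<beta> \<le> measure_pmf.expectation P (Q I g)"
    unfolding dual_le using \<beta>(2) by (simp cong: sum.cong)
  with weak[OF mem] have eq: "measure_pmf.expectation P (Q I g) = dual_objective I g ?\<beta>"
    by simp
  show ?thesis
  proof (intro exI conjI)
    show "is_arg_max (\<lambda>P. measure_pmf.expectation P (Q I g)) (\<lambda>P. P \<in> ambiguity_set I g) P"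
      using P max by (auto simp: is_arg_max_linorder)
    show "is_arg_min (dual_objective I g) (\<lambda>\<beta>. \<beta> \<in> ?J \<rightarrow>\<^sub>E {0..}) ?\<beta>"
      using mem weak eq by (auto simp only: is_arg_min_linorder)
  qed (rule eq)
qed

end
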